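(* Let $k\in[0,\infty)\cup\{\infty\}$. The social utility $J_S(\boldsymbol\tau)=\min_{i=1,\dots,n}J_i(\boldsymbol\tau)$ over $\boldsymbol\tau\in[0,1]^n$ is maximized at a homogeneous outcome $(\tau',\tau',\dots,\tau')$ for some $\tau'\in[0,1]$, and such an outcome is Pareto optimal.
   Context: Parameters: an integer $n\ge 1$ (number of stations), real constants $P>0$ (payload) and $0<\sigma<T$ (empty and busy slot durations), an integer retry limit $R\ge 0$, contention windows $1<CW_{min}\le CW_{max}$, $W(i)=\min\{2^i CW_{min},CW_{max}\}$. Define $f:[0,1]\to(0,1)$ by $$f(p)=\frac{2(1-p^{R+1})}{1-p^{R+1}+(1-p)\sum_{i=0}^R p^iW(i)}\ \ (0\le p<1),\qquad f(1)=\frac{2(R+1)}{1+\sum_{i=0}^R W(i)}.$$ Game: each player (station) $i\in\{1,\dots,n\}$ chooses $\tau_i\in[0,1]$. For $\boldsymbol\tau\in[0,1]^n$ put $p_i=1-\prod_{j\ne i}(1-\tau_j)$, $p_{AP}=1-\prod_{j=1}^n(1-\tau_j)$. The access point's transmission probability is $\tau_{AP}=f(p_{AP})$ if $k<\infty$, and $\tau_{AP}=0$ if $k=\infty$ (no downlink traffic). Put $P_{idle}=(1-p_{AP})(1-\tau_{AP})$, and $$S_u^i=\frac{\tau_i(1-p_i)(1-\tau_{AP})P}{P_{idle}\sigma+(1-P_{idle})T},\qquad S_d=\frac1n\,\frac{\tau_{AP}(1-p_{AP})P}{P_{idle}\sigma+(1-P_{idle})T}.$$ The utility of station $i$ is $J_i(\boldsymbol\tau)=\min\{S_u^i,kS_d\}$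 if $k<\infty$, and $J_i(\boldsymbol\tau)=S_u^i$ if $k=\infty$. An outcome is a vector $\boldsymbol\tau\in[0,1]^n$; it is homogeneous if all its components are equal. An outcome $\boldsymbol\tau$ is Pareto optimal if there is no outcome $\boldsymbol\rho$ with $J_i(\boldsymbol\rho)\ge J_i(\boldsymbol\tau)$ for all $i$ and $J_j(\boldsymbol\rho)>J_j(\boldsymbol\tau)$ for some $j$. *)

theory Defs
  imports Complex_Main "HOL-Library.FuncSet" "HOL-Library.Extended_Nonnegative_Real"
begin

definition window :: "real \<Rightarrow> real \<Rightarrow> nat \<Rightarrow> real" where
  "window CWmin CWmax i = min (2 ^ i * CWmin) CWmax"

definition attempt_prob :: "nat \<Rightarrow> real \<Rightarrow> real \<Rightarrow> real \<Rightarrow> real" where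
  "attempt_prob R CWmin CWmax p =
    (if p = 1 then 2 * (real R + 1) / (1 + (\<Sum>i=0..R. window CWmin CWmax i))
     else 2 * (1 - p ^ (R + 1)) /
       (1 - p ^ (R + 1) + (1 - p) * (\<Sum>i=0..R. p ^ i * window CWmin CWmax i)))"

text \<open>Outcomes are functions on the index set \<open>{1..n}\<close>, extensional so that
  \<open>outcomes n\<close> is in bijection with the cube \<open>[0,1]\<close> to the power \<open>n\<close>.\<close>

definition outcomes :: "nat \<Rightarrow> (nat \<Rightarrow> real) set" where
  "outcomes n = {1..n} \<rightarrow>\<^sub>E {0..1}"

definition homogeneous_outcome :: "nat \<Rightarrow> real \<Rightarrow> nat \<Rightarrow> real" where
  "homogeneous_outcome n t = (\<lambda>i\<in>{1..n}. t)"

definition coll_prob :: "nat \<Rightarrow> (nat \<Rightarrow> real) \<Rightarrow> nat \<Rightarrow> real" where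
  "coll_prob n \<tau> i = 1 - (\<Prod>j\<in>{1..n} - {i}. 1 - \<tau> j)"

definition coll_prob_AP :: "nat \<Rightarrow> (nat \<Rightarrow> real) \<Rightarrow> real" where
  "coll_prob_AP n \<tau> = 1 - (\<Prod>j\<in>{1..n}. 1 - \<tau> j)"

text \<open>The value \<open>k = \<infinity>\<close> encodes the absence of downlink traffic.\<close>

definition tau_AP ::
  "nat \<Rightarrow> nat \<Rightarrow> real \<Rightarrow> real \<Rightarrow> ennreal \<Rightarrow> (nat \<Rightarrow> real) \<Rightarrow> real" where
  "tau_AP n R CWmin CWmax k \<tau> =
    (if k = \<infinity> then 0 else attempt_prob R CWmin CWmax (coll_prob_AP n \<tau>))"

definition idle_prob ::
  "nat \<Rightarrow> nat \<Rightarrow> real \<Rightarrow> real \<Rightarrow> ennreal \<Rightarrow> (nat \<Rightarrow> real) \<Rightarrow> real" where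
  "idle_prob n R CWmin CWmax k \<tau> =
    (1 - coll_prob_AP n \<tau>) * (1 - tau_AP n R CWmin CWmax k \<tau>)"

definition mean_slot ::
  "nat \<Rightarrow> real \<Rightarrow> real \<Rightarrow> nat \<Rightarrow> real \<Rightarrow> real \<Rightarrow> ennreal \<Rightarrow> (nat \<Rightarrow> real) \<Rightarrow> real" where
  "mean_slot n \<sigma> T R CWmin CWmax k \<tau> =
    idle_prob n R CWmin CWmax k \<tau> * \<sigma> + (1 - idle_prob n R CWmin CWmax k \<tau>) * T"

definition uplink ::
  "nat \<Rightarrow> real \<Rightarrow> real \<Rightarrow> real \<Rightarrow> nat \<Rightarrow> real \<Rightarrow> real \<Rightarrow> ennreal \<Rightarrow> nat \<Rightarrow> (nat \<Rightarrow> real) \<Rightarrow> real" where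
  "uplink n P \<sigma> T R CWmin CWmax k i \<tau> =
    \<tau> i * (1 - coll_prob n \<tau> i) * (1 - tau_AP n R CWmin CWmax k \<tau>) * P /
      mean_slot n \<sigma> T R CWmin CWmax k \<tau>"

definition downlink ::
  "nat \<Rightarrow> real \<Rightarrow> real \<Rightarrow> real \<Rightarrow> nat \<Rightarrow> real \<Rightarrow> real \<Rightarrow> ennreal \<Rightarrow> (nat \<Rightarrow> real) \<Rightarrow> real" where
  "downlink n P \<sigma> T R CWmin CWmax k \<tau> =
    1 / real n * (tau_AP n R CWmin CWmax k \<tau> * (1 - coll_prob_AP n \<tau>) * P /
      mean_slot n \<sigma> T R CWmin CWmax k \<tau>)"

definition utility ::
  "nat \<Rightarrow> real \<Rightarrow> real \<Rightarrow> real \<Rightarrow> nat \<Rightarrow> real \<Rightarrow> real \<Rightarrow> ennreal \<Rightarrow> nat \<Rightarrow> (nat \<Rightarrow> real) \<Rightarrow> real" where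
  "utility n P \<sigma> T R CWmin CWmax k i \<tau> =
    (if k = \<infinity> then uplink n P \<sigma> T R CWmin CWmax k i \<tau>
     else min (uplink n P \<sigma> T R CWmin CWmax k i \<tau>)
              (enn2real k * downlink n P \<sigma> T R CWmin CWmax k \<tau>))"

definition social_utility ::
  "nat \<Rightarrow> real \<Rightarrow> real \<Rightarrow> real \<Rightarrow> nat \<Rightarrow> real \<Rightarrow> real \<Rightarrow> ennreal \<Rightarrow> (nat \<Rightarrow> real) \<Rightarrow> real" where
  "social_utility n P \<sigma> T R CWmin CWmax k \<tau> =
    Min ((\<lambda>i. utility n P \<sigma> T R CWmin CWmax k i \<tau>) ` {1..n})"

definition pareto_optimal ::
  "nat \<Rightarrow> (nat \<Rightarrow> (nat \<Rightarrow> real) \<Rightarrow> real) \<Rightarrow> (nat \<Rightarrow> real) \<Rightarrow> bool" where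
  "pareto_optimal n J \<tau> \<longleftrightarrow> \<tau> \<in> outcomes n \<and>
    \<not> (\<exists>\<rho>\<in>outcomes n. (\<forall>i\<in>{1..n}. J i \<rho> \<ge> J i \<tau>) \<and> (\<exists>j\<in>{1..n}. J j \<rho> > J j \<tau>))"

end

theory Submission imports Defs begin

text \<open>All slot probabilities, and hence the downlink share, depend on an outcome \<open>x\<close> only through
  \<open>\<Prod>j. 1 - x j\<close>, and for a given positive value of this product the uplink share of \<open>i\<close> is
  proportional to the odds \<open>x i / (1 - x i)\<close>. Replacing every \<open>1 - x j\<close> by their geometric mean
  keeps the product and raises the smallest odds, strictly unless \<open>x\<close> is already homogeneous.
  So it suffices to maximize over homogeneous outcomes, where compactness applies. If a maximizer
  were Pareto dominated, the dominating outcome either would exceed the maximum for every player,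
  or would be inhomogeneous and could be strictly improved by homogenizing it.\<close>

section \<open>Attempt probability of the access point\<close>

text \<open>The continuous extension of the attempt probability from \<open>p < 1\<close>. It differs from
  \<open>attempt_prob\<close> at \<open>p = 1\<close> when \<open>R > 0\<close>: there the latter has denominator
  \<open>1 + \<dots>\<close> instead of \<open>R + 1 + \<dots>\<close> and may even exceed 1.\<close>

definition attempt_ext :: "nat \<Rightarrow> real \<Rightarrow> real \<Rightarrow> real \<Rightarrow> real" where
  "attempt_ext R CWmin CWmax p =
    2 * (\<Sum>i=0..R. p ^ i) / ((\<Sum>i=0..R. p ^ i) + (\<Sum>i=0..R. p ^ i * window CWmin CWmax i))"

text \<open>By the geometric sum, \<open>1 - p\<close> is a common factor of numerator and
  denominator and cancels.\<close>

lemma attempt_prob_eq_ext: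
  assumes "p \<noteq> 1"
  shows "attempt_prob R CWmin CWmax p = attempt_ext R CWmin CWmax p"
proof -
  have "1 - p ^ (R + 1) = (1 - p) * (\<Sum>i=0..R. p ^ i)"
    using one_diff_power_eq[of p "R + 1"] by (simp add: atLeast0AtMost lessThan_Suc_atMost)
  moreover have "1 - p \<noteq> 0" using assms by simp
  ultimately show ?thesis
    using assms unfolding attempt_prob_def attempt_ext_def
    by (simp add: distrib_left[symmetric] del: power_Suc)
qed

lemma window_gt_1:
  assumes "1 < CWmin" "CWmin \<le> CWmax"
  shows "1 < window CWmin CWmax i"
proof -
  have "1 * 1 < 2 ^ i * CWmin"
    using assms by (intro mult_le_less_imp_less) auto
  then show ?thesis using assms by (simp add: window_def)
qed

lemma attempt_ext_denominator:
  assumes "1 < CWmin" "CWmin \<le> CWmax" "0 \<le> p"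
  shows "(\<Sum>i=0..R. p ^ i) \<ge> 1"
    and "(\<Sum>i=0..R. p ^ i) < (\<Sum>i=0..R. p ^ i * window CWmin CWmax i)"
proof -
  have w: "1 < window CWmin CWmax i" for i using window_gt_1 assms by blast
  have "(\<Sum>i\<in>{0}. p ^ i) \<le> (\<Sum>i=0..R. p ^ i)"
    using assms by (intro sum_mono2) auto
  then show "(\<Sum>i=0..R. p ^ i) \<ge> 1" by simp
  show "(\<Sum>i=0..R. p ^ i) < (\<Sum>i=0..R. p ^ i * window CWmin CWmax i)"
  proof (rule sum_strict_mono_ex1)
    show "\<forall>i\<in>{0..R}. p ^ i \<le> p ^ i * window CWmin CWmax i"
      using w assms(3) by (auto simp: mult_le_cancel_left1 less_imp_le)
    \<comment> \<open>The term at index 0 is strict even for \<open>p = 0\<close>, since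
      \<open>p ^ 0 = 1\<close>.\<close>
    show "\<exists>i\<in>{0..R}. p ^ i < p ^ i * window CWmin CWmax i"
      using w[of 0] by (intro bexI[of _ 0]) auto
  qed simp
qed

lemma attempt_ext_bounds:
  assumes "1 < CWmin" "CWmin \<le> CWmax" "0 \<le> p"
  shows "0 < attempt_ext R CWmin CWmax p" "attempt_ext R CWmin CWmax p < 1"
  using attempt_ext_denominator[OF assms, of R] unfolding attempt_ext_def
  by (auto simp: divide_simps)

lemma continuous_on_attempt_ext:
  assumes "1 < CWmin" "CWmin \<le> CWmax"
  shows "continuous_on {0..} (attempt_ext R CWmin CWmax)"
proof -
  have "(\<Sum>i=0..R. p ^ i) + (\<Sum>i=0..R. p ^ i * window CWmin CWmax i) \<noteq> 0" if "p \<in> {0..}" for p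
    using attempt_ext_denominator[OF assms, of p R] that by simp
  then show ?thesis
    unfolding attempt_ext_def by (intro continuous_intros) auto
qed

section \<open>Bounds on probabilities, slots and throughputs\<close>

locale wlan_game =
  fixes n R :: nat and P \<sigma> T CWmin CWmax :: real and k :: ennreal
  assumes n_pos: "n \<ge> 1" and P_pos: "P > 0" and \<sigma>_pos: "0 < \<sigma>" and \<sigma>_less_T: "\<sigma> < T"
    and CWmin_gt_1: "1 < CWmin" and CWmin_le_CWmax: "CWmin \<le> CWmax"
begin

abbreviation "hom \<equiv> homogeneous_outcome n"
abbreviation "pAP \<equiv> coll_prob_AP n"
abbreviation "aAP \<equiv> tau_AP n R CWmin CWmax k"
abbreviation "slot \<equiv> mean_slot n \<sigma> T R CWmin CWmax k"
abbreviation "Su \<equiv> uplink n P \<sigma> T R CWmin CWmax k"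
abbreviation "Sd \<equiv> downlink n P \<sigma> T R CWmin CWmax k"
abbreviation "J \<equiv> utility n P \<sigma> T R CWmin CWmax k"
abbreviation "JS \<equiv> social_utility n P \<sigma> T R CWmin CWmax k"

lemma outcome_bounds:
  assumes "x \<in> outcomes n" "j \<in> {1..n}"
  shows "0 \<le> x j" "x j \<le> 1"
  using assms by (auto simp: outcomes_def PiE_def Pi_def)

lemma hom_outcome: "t \<in> {0..1} \<Longrightarrow> hom t \<in> outcomes n"
  by (auto simp: outcomes_def homogeneous_outcome_def)

lemma pAP_bounds:
  assumes "x \<in> outcomes n"
  shows "0 \<le> pAP x" "pAP x \<le> 1"
proof -
  have "0 \<le> (\<Prod>j\<in>{1..n}. 1 - x j)" "(\<Prod>j\<in>{1..n}. 1 - x j) \<le> 1"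
    using outcome_bounds[OF assms] by (auto intro!: prod_nonneg prod_le_1)
  then show "0 \<le> pAP x" "pAP x \<le> 1" by (auto simp: coll_prob_AP_def)
qed

lemma one_minus_coll_prob_nonneg: "x \<in> outcomes n \<Longrightarrow> 0 \<le> 1 - coll_prob n x i"
  unfolding coll_prob_def using outcome_bounds by (auto intro!: prod_nonneg)

lemma one_minus_pAP_split:
  assumes "i \<in> {1..n}"
  shows "1 - pAP x = (1 - x i) * (1 - coll_prob n x i)"
  using assms unfolding coll_prob_AP_def coll_prob_def by (simp add: prod.remove[of _ i])

text \<open>The excluded case is the one where \<open>aAP\<close> takes the separate value of
  \<open>attempt_prob\<close> at 1, which can exceed 1.\<close>

lemma aAP_bounds:
  assumes "x \<in> outcomes n" "k = \<infinity> \<or> pAP x \<noteq> 1"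
  shows "0 \<le> aAP x" "aAP x < 1"
  using assms attempt_ext_bounds[OF CWmin_gt_1 CWmin_le_CWmax pAP_bounds(1)[OF assms(1)], of R]
  by (auto simp: tau_AP_def attempt_prob_eq_ext)

text \<open>The mean slot is \<open>T\<close> minus the idle probability times
  \<open>T - \<sigma>\<close>, hence at least \<open>\<sigma>\<close>. At \<open>pAP x = 1\<close>
  the idle probability is 0 whatever \<open>aAP x\<close> is.\<close>

lemma slot_pos:
  assumes "x \<in> outcomes n"
  shows "0 < slot x"
proof -
  have "(1 - pAP x) * (1 - aAP x) \<le> 1"
  proof (cases "pAP x = 1")
    case False
    then show ?thesis
      using aAP_bounds[OF assms] pAP_bounds[OF assms] by (intro mult_le_one) auto
  qed simp
  then have "(1 - pAP x) * (1 - aAP x) * (T - \<sigma>) \<le> 1 * (T - \<sigma>)"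
    using \<sigma>_less_T by (intro mult_right_mono) auto
  then show ?thesis
    using \<sigma>_pos by (simp add: mean_slot_def idle_prob_def algebra_simps)
qed

lemma JS_le: "i \<in> {1..n} \<Longrightarrow> JS x \<le> J i x"
  unfolding social_utility_def by (intro Min_le) auto

lemma JS_greater: "(\<And>i. i \<in> {1..n} \<Longrightarrow> c < J i x) \<Longrightarrow> c < JS x"
  unfolding social_utility_def using n_pos by (subst Min_gr_iff) auto

lemma coll_prob_hom: "i \<in> {1..n} \<Longrightarrow> coll_prob n (hom t) i = 1 - (1 - t) ^ (n - 1)"
  by (simp add: coll_prob_def homogeneous_outcome_def)

lemma pAP_hom: "pAP (hom t) = 1 - (1 - t) ^ n"
  by (simp add: coll_prob_AP_def homogeneous_outcome_def)

lemma J_hom: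
  assumes "i \<in> {1..n}"
  shows "J i (hom t) = JS (hom t)"
proof -
  have "J j (hom t) = J i (hom t)" if "j \<in> {1..n}" for j
    using assms that coll_prob_hom[OF assms] coll_prob_hom[OF that]
    by (simp add: utility_def uplink_def homogeneous_outcome_def)
  then have "(\<lambda>j. J j (hom t)) ` {1..n} = (\<lambda>j. J i (hom t)) ` {1..n}"
    by (intro image_cong refl)
  also have "\<dots> = {J i (hom t)}" using n_pos by auto
  finally show ?thesis by (simp add: social_utility_def)
qed

lemma Sd_nonneg:
  assumes "x \<in> outcomes n" "k \<noteq> \<infinity>"
  shows "0 \<le> Sd x"
  using assms slot_pos[OF assms(1)] pAP_bounds[OF assms(1)] aAP_bounds(1)[OF assms(1)] P_pos
  by (cases "pAP x = 1") (auto simp: downlink_def intro!: divide_nonneg_pos)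

lemma Sd_eq_0: "pAP x = 1 \<Longrightarrow> Sd x = 0"
  by (simp add: downlink_def)

text \<open>Silence of all stations is the baseline that degenerate outcomes with
  \<open>pAP x = 1\<close> are compared with.\<close>

lemma JS_hom_0: "JS (hom 0) = 0"
proof -
  have "0 \<le> enn2real k * Sd (hom 0)" if "k \<noteq> \<infinity>"
    using Sd_nonneg[OF hom_outcome that] by simp
  then have "J 1 (hom 0) = 0"
    using n_pos by (simp add: utility_def uplink_def homogeneous_outcome_def)
  then show ?thesis using J_hom[of 1] n_pos by simp
qed

section \<open>Homogenization at a fixed collision probability\<close>

lemma homogenize:
  assumes x: "x \<in> outcomes n" and q: "pAP x \<noteq> 1"
    and i: "i \<in> {1..n}" and min: "\<forall>j\<in>{1..n}. x i \<le> x j"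
  shows "\<exists>t\<in>{0..<1}. pAP (hom t) = pAP x \<and> x i \<le> t \<and> ((\<exists>j\<in>{1..n}. x i < x j) \<longrightarrow> x i < t)"
proof -
  define q where "q = (\<Prod>j\<in>{1..n}. 1 - x j)"
  \<comment> \<open>\<open>1 - t\<close> is the geometric mean of the factors
    \<open>1 - x j\<close>, so \<open>hom t\<close> has the same product \<open>q\<close>.\<close>
  define t where "t = 1 - root n q"
  have q01: "0 < q" "q \<le> 1"
    using pAP_bounds[OF x] q unfolding q_def coll_prob_AP_def by linarith+
  have n0: "0 < n" using n_pos by simp
  have pow: "(1 - t) ^ n = q" using q01 n0 by (simp add: t_def)
  have t1: "t < 1" "0 \<le> t" using q01 n0 by (auto simp: t_def)
  have x1: "x j < 1" if "j \<in> {1..n}" for j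
  proof -
    have "1 - x j \<noteq> 0"
      using q01 that unfolding q_def by (metis finite_atLeastAtMost less_irrefl prod_zero)
    then show ?thesis using outcome_bounds[OF x that] by simp
  qed
  have le: "x i \<le> t"
  proof -
    \<comment> \<open>By minimality of \<open>x i\<close>, the largest factor is
      \<open>1 - x i\<close>.\<close>
    have "q \<le> (\<Prod>j\<in>{1..n}. 1 - x i)"
      unfolding q_def using min x1 by (intro prod_mono) (auto simp: less_imp_le)
    then have "(1 - t) ^ n \<le> (1 - x i) ^ n" using pow by simp
    then show ?thesis using x1[OF i] n0 t1 by (simp add: power_mono_iff)
  qed
  have less: "x i < t" if "j \<in> {1..n}" "x i < x j" for j
  proof -
    \<comment> \<open>One strictly smaller factor suffices, because all factors are
      positive.\<close>
    have "q < (\<Prod>j\<in>{1..n}. 1 - x i)"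
      unfolding q_def
      using min i that x1 by (intro prod_mono_strict[of j]) (auto simp: less_imp_le)
    then have "(1 - t) ^ n < (1 - x i) ^ n" using pow by simp
    then show ?thesis
      using power_less_imp_less_base[of "1 - t" n "1 - x i"] x1[OF i] by simp
  qed
  have "pAP (hom t) = pAP x" using pow pAP_hom by (simp add: q_def coll_prob_AP_def)
  then show ?thesis using t1 le less by (intro bexI[of _ t]) auto
qed

lemma same_pAP:
  assumes "pAP x = pAP y"
  shows "aAP x = aAP y" "slot x = slot y" "Sd x = Sd y"
  using assms by (simp_all add: tau_AP_def mean_slot_def idle_prob_def downlink_def)

text \<open>\<open>1 - coll_prob n x i\<close> is \<open>1 - pAP x\<close> divided by
  \<open>1 - x i\<close>; everything but the odds then depends on \<open>pAP x\<close>
  alone.\<close>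

lemma Su_eq_odds:
  assumes "i \<in> {1..n}" "x i < 1"
  shows "Su i x = x i / (1 - x i) * ((1 - pAP x) * (1 - aAP x) * P / slot x)"
  using assms one_minus_pAP_split[OF assms(1), of x] by (simp add: uplink_def)

text \<open>The common factor is positive and the odds increase below 1. Two outcomes and two
  players are allowed, so that the lemma compares an outcome with its homogenization and also two
  players within one outcome.\<close>

lemma Su_mono:
  assumes "x \<in> outcomes n" "y \<in> outcomes n" "pAP x \<noteq> 1" "pAP y = pAP x" "i \<in> {1..n}" "j \<in> {1..n}"
    "x i < 1" "y j < 1"
  shows "x i \<le> y j \<Longrightarrow> Su i x \<le> Su j y" "x i < y j \<Longrightarrow> Su i x < Su j y"
proof -
  have c: "0 < (1 - pAP x) * (1 - aAP x) * P / slot x"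
    using slot_pos[OF assms(1)] pAP_bounds[OF assms(1)] aAP_bounds[OF assms(1)] P_pos assms(3)
    by simp
  have u: "Su i x = x i / (1 - x i) * ((1 - pAP x) * (1 - aAP x) * P / slot x)"
    "Su j y = y j / (1 - y j) * ((1 - pAP x) * (1 - aAP x) * P / slot x)"
    using Su_eq_odds[of i x] Su_eq_odds[of j y] same_pAP[OF assms(4)] assms by simp_all
  have "x i / (1 - x i) \<le> y j / (1 - y j)" if "x i \<le> y j"
    using that assms(7,8) by (simp add: divide_simps algebra_simps)
  then show "x i \<le> y j \<Longrightarrow> Su i x \<le> Su j y" unfolding u using c by (intro mult_right_mono) auto
  have "x i / (1 - x i) < y j / (1 - y j)" if "x i < y j"
    using that assms(7,8) by (simp add: divide_simps algebra_simps)
  then show "x i < y j \<Longrightarrow> Su i x < Su j y" unfolding u using c by (intro mult_strict_right_mono) auto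
qed

lemma lt_1_of_pAP:
  assumes "x \<in> outcomes n" "pAP x \<noteq> 1" "i \<in> {1..n}"
  shows "x i < 1"
proof -
  have "1 - x i \<noteq> 0" using one_minus_pAP_split[OF assms(3), of x] assms(2) by auto
  then show ?thesis using outcome_bounds[OF assms(1,3)] by simp
qed

lemma minimal_player:
  "\<exists>i\<in>{1..n}. \<forall>j\<in>{1..n}. (x i :: real) \<le> x j"
proof -
  have "Min (x ` {1..n}) \<in> x ` {1..n}" using n_pos by (intro Min_in) auto
  then obtain i where i: "i \<in> {1..n}" "x i = Min (x ` {1..n})" by auto
  then show ?thesis by (intro bexI[of _ i]) simp_all
qed

text \<open>Homogenizing keeps the downlink share and does not lower the uplink share of a station
  with the least \<open>x i\<close>; the utility of that station bounds \<open>JS x\<close> from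
  above.\<close>

lemma JS_le_hom_pos:
  assumes x: "x \<in> outcomes n" and q: "pAP x \<noteq> 1"
  shows "\<exists>t\<in>{0..1}. JS x \<le> JS (hom t)"
proof -
  obtain i where i: "i \<in> {1..n}" "\<forall>j\<in>{1..n}. x i \<le> x j"
    using minimal_player[of x] by blast
  obtain t where t: "t \<in> {0..1}" "t < 1" "pAP (hom t) = pAP x" "x i \<le> t"
    using homogenize[OF x q i] by auto
  have "hom t i = t" using i by (simp add: homogeneous_outcome_def)
  then have "Su i x \<le> Su i (hom t)"
    using Su_mono(1)[OF x hom_outcome q t(3) i(1) i(1)] t lt_1_of_pAP[OF x q i(1)] by simp
  then have "J i x \<le> J i (hom t)"
    using same_pAP(3)[OF t(3)] by (auto simp: utility_def)
  then have "JS x \<le> JS (hom t)" using JS_le[OF i(1), of x] J_hom[OF i(1), of t] by simp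
  then show ?thesis using t(1) by blast
qed

text \<open>A station that transmits surely makes every other station collide surely. A second
  station is essential: for \<open>n = 1\<close> the collision probability is always 0.\<close>

lemma pAP_neq_1:
  assumes x: "x \<in> outcomes n" and n: "n \<ge> 2" and pos: "\<And>i. i \<in> {1..n} \<Longrightarrow> coll_prob n x i \<noteq> 1"
  shows "pAP x \<noteq> 1"
proof
  assume "pAP x = 1"
  then obtain j where j: "j \<in> {1..n}" "x j = 1" by (auto simp: coll_prob_AP_def)
  obtain i where i: "i \<in> {1..n}" "i \<noteq> j"
    using n by (metis One_nat_def atLeastAtMost_iff le_antisym nle_le not_less_eq_eq numeral_2_eq_2)
  have "coll_prob n x i = 1"
    unfolding coll_prob_def using i j by auto
  then show False using pos i by blast
qed

lemma singleton_hom: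
  assumes "x \<in> outcomes n" "n = 1"
  shows "x = hom (x 1)"
  using assms by (auto simp: outcomes_def homogeneous_outcome_def fun_eq_iff PiE_def extensional_def)

lemma JS_le_hom:
  assumes x: "x \<in> outcomes n"
  shows "\<exists>t\<in>{0..1}. JS x \<le> JS (hom t)"
proof (cases "pAP x = 1")
  case True
  have one: "1 \<in> {1..n}" using n_pos by simp
  \<comment> \<open>With finite \<open>k\<close> the downlink vanishes, and with several stations
    and no downlink some station surely collides; both give at most 0. A single station is
    homogeneous anyway.\<close>
  consider "k \<noteq> \<infinity>" | "k = \<infinity>" "n = 1" | "k = \<infinity>" "n \<ge> 2" using n_pos by linarith
  then show ?thesis
  proof cases
    case 1
    then have "J 1 x \<le> 0" using Sd_eq_0[OF True] by (simp add: utility_def)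
    then show ?thesis using JS_le[OF one, of x] JS_hom_0 by (intro bexI[of _ 0]) simp_all
  next
    case 2
    show ?thesis
      using outcome_bounds[OF x one] singleton_hom[OF x 2(2)] by (intro bexI[of _ "x 1"]) simp_all
  next
    case 3
    then obtain i where i: "i \<in> {1..n}" "coll_prob n x i = 1"
      using pAP_neq_1[OF x] True by blast
    then have "J i x = 0" using 3 by (simp add: utility_def uplink_def)
    then show ?thesis using JS_le[OF i(1), of x] JS_hom_0 by (intro bexI[of _ 0]) simp_all
  qed
next
  case False
  then show ?thesis using JS_le_hom_pos[OF x] by blast
qed

section \<open>Compactness over homogeneous outcomes\<close>

text \<open>The social utility of the homogeneous outcome, made continuous at \<open>t = 1\<close>.\<close>

definition hom_utility :: "real \<Rightarrow> real" where
  "hom_utility t =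
    (let a = (if k = \<infinity> then 0 else attempt_ext R CWmin CWmax (1 - (1 - t) ^ n));
         d = (1 - t) ^ n * (1 - a) * \<sigma> + (1 - (1 - t) ^ n * (1 - a)) * T;
         u = t * (1 - t) ^ (n - 1) * (1 - a) * P / d
     in if k = \<infinity> then u else min u (enn2real k * (1 / real n * (a * (1 - t) ^ n * P / d))))"

lemma hom_utility_eq:
  assumes "t \<in> {0..1}" "k = \<infinity> \<or> t < 1"
  shows "JS (hom t) = hom_utility t"
proof -
  have one: "1 \<in> {1..n}" using n_pos by simp
  have "k = \<infinity> \<or> pAP (hom t) \<noteq> 1" using assms by (auto simp: pAP_hom)
  then have a: "aAP (hom t) = (if k = \<infinity> then 0 else attempt_ext R CWmin CWmax (1 - (1 - t) ^ n))"
    by (auto simp: tau_AP_def pAP_hom attempt_prob_eq_ext)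
  have h: "hom t 1 = t" using one by (simp add: homogeneous_outcome_def)
  have "JS (hom t) = J 1 (hom t)" using J_hom[OF one] by simp
  also have "\<dots> = hom_utility t"
    unfolding hom_utility_def utility_def uplink_def downlink_def mean_slot_def idle_prob_def
      a coll_prob_hom[OF one] pAP_hom h Let_def by simp
  finally show ?thesis .
qed

lemma continuous_on_hom_utility: "continuous_on {0..1} hom_utility"
proof -
  define a where "a t = (if k = \<infinity> then 0 else attempt_ext R CWmin CWmax (1 - (1 - t) ^ n))" for t
  have p: "0 \<le> (1 - t) ^ n" "(1 - t) ^ n \<le> 1" if "t \<in> {0..1}" for t :: real
    using that by (auto intro: power_le_one)
  have "continuous_on {0..1} (\<lambda>t. attempt_ext R CWmin CWmax (1 - (1 - t) ^ n))"
    by (rule continuous_on_compose2[OF continuous_on_attempt_ext[OF CWmin_gt_1 CWmin_le_CWmax]])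
      (use p in \<open>auto intro!: continuous_intros\<close>)
  then have a_cont: "continuous_on {0..1} a" unfolding a_def by (cases "k = \<infinity>") simp_all
  have a01: "0 \<le> a t" "a t \<le> 1" if "t \<in> {0..1}" for t
    using attempt_ext_bounds[OF CWmin_gt_1 CWmin_le_CWmax, of "1 - (1 - t) ^ n" R] p[OF that]
    by (auto simp: a_def)
  \<comment> \<open>The estimate of \<open>slot_pos\<close>, repeated for the extended attempt
    probability, whose bounds persist at 1.\<close>
  have d: "(1 - t) ^ n * (1 - a t) * \<sigma> + (1 - (1 - t) ^ n * (1 - a t)) * T \<noteq> 0"
    if "t \<in> {0..1}" for t
  proof -
    have "(1 - t) ^ n * (1 - a t) \<le> 1" using p a01 that by (intro mult_le_one) auto
    then have "(1 - t) ^ n * (1 - a t) * (T - \<sigma>) \<le> 1 * (T - \<sigma>)"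
      using \<sigma>_less_T by (intro mult_right_mono) auto
    then show ?thesis using \<sigma>_pos by (simp add: algebra_simps)
  qed
  have "continuous_on {0..1} (\<lambda>t. t * (1 - t) ^ (n - 1) * (1 - a t) * P /
      ((1 - t) ^ n * (1 - a t) * \<sigma> + (1 - (1 - t) ^ n * (1 - a t)) * T))"
    using d by (intro continuous_intros a_cont) auto
  moreover have "continuous_on {0..1} (\<lambda>t. enn2real k * (1 / real n * (a t * (1 - t) ^ n * P /
      ((1 - t) ^ n * (1 - a t) * \<sigma> + (1 - (1 - t) ^ n * (1 - a t)) * T))))"
    using d by (intro continuous_intros a_cont) auto
  ultimately show ?thesis
    unfolding hom_utility_def Let_def a_def[symmetric]
    by (cases "k = \<infinity>") (auto intro!: continuous_on_min)
qed

lemma exists_best_hom: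
  "\<exists>t\<in>{0..1}. \<forall>s\<in>{0..1}. JS (hom s) \<le> JS (hom t)"
proof -
  obtain m where m: "m \<in> {0..1}" "\<forall>s\<in>{0..1}. hom_utility s \<le> hom_utility m"
    using continuous_attains_sup[OF _ _ continuous_on_hom_utility] by auto
  have one: "1 \<in> {1..n}" using n_pos by simp
  txt \<open>For finite \<open>k\<close> the continuous version may differ from the social utility at \<open>1\<close>, but both
    are at most their common value \<open>0\<close> at \<open>0\<close>.\<close>
  show ?thesis
  proof (cases "k = \<infinity>")
    case True
    then show ?thesis using m hom_utility_eq by auto
  next
    case False
    define t where "t = (if m = 1 then 0 else m)"
    have h0: "hom_utility 0 = 0" using hom_utility_eq[of 0] JS_hom_0 by simp
    have "hom_utility 1 \<le> 0" using False n_pos by (simp add: hom_utility_def Let_def zero_power)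
    then have t: "t \<in> {0..1}" "t < 1" "hom_utility m \<le> hom_utility t"
      using m(1) h0 by (auto simp: t_def)
    have "JS (hom s) \<le> JS (hom t)" if s: "s \<in> {0..1}" for s
    proof (cases "s = 1")
      case True
      then have "Sd (hom s) = 0" using n_pos by (intro Sd_eq_0) (simp add: pAP_hom)
      then have "J 1 (hom s) \<le> 0" using False by (simp add: utility_def)
      then have "JS (hom s) \<le> hom_utility 0" using J_hom[OF one] h0 by simp
      also have "\<dots> \<le> hom_utility t" using m(2) t(3) by force
      finally show ?thesis using hom_utility_eq t by simp
    next
      case False
      then have "JS (hom s) = hom_utility s" using s by (intro hom_utility_eq) auto
      then show ?thesis using m(2) s t hom_utility_eq by fastforce
    qed
    then show ?thesis using t by blast
  qed
qed

section \<open>Pareto optimality of the maximizers\<close>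

lemma JS_hom_half_pos:
  assumes "k = \<infinity>"
  shows "0 < JS (hom (1 / 2))"
proof -
  have one: "1 \<in> {1..n}" using n_pos by simp
  have o: "hom (1 / 2) \<in> outcomes n" by (intro hom_outcome) simp
  have "0 < J 1 (hom (1 / 2))"
    using assms coll_prob_hom[OF one, of "1/2"] slot_pos[OF o] P_pos n_pos
    by (simp add: utility_def uplink_def tau_AP_def homogeneous_outcome_def)
  then show ?thesis using J_hom[OF one] by simp
qed

lemma best_hom_pareto:
  assumes t: "t \<in> {0..1}" and best: "\<And>y. y \<in> outcomes n \<Longrightarrow> JS y \<le> JS (hom t)"
  shows "pareto_optimal n J (hom t)"
  unfolding pareto_optimal_def
proof (intro conjI notI)
  show "hom t \<in> outcomes n" using hom_outcome t by blast
  define M where "M = JS (hom t)"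
  assume "\<exists>\<rho>\<in>outcomes n. (\<forall>i\<in>{1..n}. J i (hom t) \<le> J i \<rho>) \<and> (\<exists>j\<in>{1..n}. J j (hom t) < J j \<rho>)"
  then obtain x j where x: "x \<in> outcomes n" and dom: "\<And>i. i \<in> {1..n} \<Longrightarrow> M \<le> J i x"
    and j: "j \<in> {1..n}" "M < J j x"
    using J_hom M_def by force
  have M0: "0 \<le> M" using best[OF hom_outcome, of 0] JS_hom_0 by (simp add: M_def)
  have not_all: "\<exists>i\<in>{1..n}. J i x \<le> M"
    using JS_greater[of M x] best[OF x] M_def by force
  have q: "pAP x \<noteq> 1"
  proof (cases "k = \<infinity>")
    case True
    \<comment> \<open>Without downlink the maximum is positive, whereas a surely colliding station
      gets 0.\<close>
    have "0 < M" using JS_hom_half_pos[OF True] best[OF hom_outcome, of "1/2"] by (simp add: M_def)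
    then have "coll_prob n x i \<noteq> 1" if "i \<in> {1..n}" for i
      using dom[OF that] True by (auto simp: utility_def uplink_def)
    moreover have "n \<ge> 2"
    proof (rule ccontr)
      assume "\<not> n \<ge> 2"
      then have "n = 1" using n_pos by simp
      then show False using not_all j by auto
    qed
    ultimately show ?thesis using pAP_neq_1[OF x] by blast
  next
    case False
    \<comment> \<open>A vanishing downlink share would force \<open>J j x\<close> to be at most
      0.\<close>
    then show ?thesis using j M0 Sd_eq_0[of x] by (auto simp: utility_def)
  qed
  have lt1: "x i < 1" if "i \<in> {1..n}" for i using lt_1_of_pAP[OF x q that] .
  obtain l where l: "l \<in> {1..n}" "J l x \<le> M" using not_all by blast
  have "J l x < J j x" using l j by simp
  \<comment> \<open>The downlink term is common to all players, so a strict gap in utility must come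
    from the uplink.\<close>
  then have "Su l x < Su j x" by (auto simp: utility_def min_def split: if_splits)
  then have lj: "x l < x j"
    using Su_mono(1)[OF x x q refl j(1) l(1)] lt1 l j by force
  obtain i where i: "i \<in> {1..n}" "\<forall>j\<in>{1..n}. x i \<le> x j"
    using minimal_player[of x] by blast
  have ij: "x i < x j" using i(2) l(1) lj by force
  obtain s where s: "s \<in> {0..1}" "s < 1" "pAP (hom s) = pAP x" "x i < s"
    using homogenize[OF x q i] j(1) ij by auto
  have "hom s i = s" using i by (simp add: homogeneous_outcome_def)
  then have "Su i x < Su i (hom s)"
    using Su_mono(2)[OF x hom_outcome q s(3) i(1) i(1)] s lt1 i by simp
  moreover have "M \<le> Su i x" using dom[OF i(1)] by (auto simp: utility_def split: if_splits)
  \<comment> \<open>Player \<open>j\<close> already witnesses that the downlink term exceeds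
    \<open>M\<close>, and homogenizing preserves it.\<close>
  moreover have "M < enn2real k * Sd (hom s)" if "k \<noteq> \<infinity>"
    using j(2) that same_pAP(3)[OF s(3)] by (simp add: utility_def)
  ultimately have "M < J i (hom s)" by (auto simp: utility_def)
  then show False using J_hom[OF i(1), of s] best[OF hom_outcome[OF s(1)]] by (simp add: M_def)
qed

end

theorem proposition2p4:
  fixes n R :: nat and P \<sigma> T CWmin CWmax :: real and k :: ennreal
  assumes "n \<ge> 1" and "P > 0" and "0 < \<sigma>" and "\<sigma> < T"
    and "1 < CWmin" and "CWmin \<le> CWmax"
  shows "(\<exists>\<tau>'\<in>{0..1}. is_arg_max (social_utility n P \<sigma> T R CWmin CWmax k)
            (\<lambda>\<tau>. \<tau> \<in> outcomes n) (homogeneous_outcome n \<tau>')) \<and>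
         (\<forall>\<tau>'\<in>{0..1}. is_arg_max (social_utility n P \<sigma> T R CWmin CWmax k)
            (\<lambda>\<tau>. \<tau> \<in> outcomes n) (homogeneous_outcome n \<tau>') \<longrightarrow>
          pareto_optimal n (utility n P \<sigma> T R CWmin CWmax k) (homogeneous_outcome n \<tau>'))"
proof -
  interpret wlan_game n R P \<sigma> T CWmin CWmax k
    using assms by unfold_locales
  obtain t where t: "t \<in> {0..1}" "\<forall>s\<in>{0..1}. JS (hom s) \<le> JS (hom t)"
    using exists_best_hom by blast
  have "JS x \<le> JS (hom t)" if "x \<in> outcomes n" for x
    using JS_le_hom[OF that] t(2) by (meson order_trans)
  then have "is_arg_max JS (\<lambda>\<tau>. \<tau> \<in> outcomes n) (hom t)"
    using t(1) hom_outcome by (auto simp: is_arg_max_linorder)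
  then show ?thesis
    using t(1) best_hom_pareto by (auto simp: is_arg_max_linorder)
qed

end
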